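(* Let $a>b>0$ and $\lambda\ne0$. The set $\mathfrak C_0=\{\zeta\in P^6:\operatorname{rank}J(\zeta)=0\}$ for the momentum map $J=G\times K\times H:P^6\to\mathbb R^3$ of the Kowalevski gyrostat in two constant fields consists exactly of the four equilibria existing in this problem, namely the points $\boldsymbol\omega=0,\ \boldsymbol\alpha=\pm a\mathbf e_1,\ \boldsymbol\beta=\pm b\mathbf e_2$ (all four combinations of signs).
   Context: Phase space. Fix real $a>b>0$ and $\lambda\ne0$. $P^6=\{(\boldsymbol\omega,\boldsymbol\alpha,\boldsymbol\beta)\in\mathbb R^3\times\mathbb R^3\times\mathbb R^3:\ \boldsymbol\alpha\cdot\boldsymbol\alpha=a^2,\ \boldsymbol\beta\cdot\boldsymbol\beta=b^2,\ \boldsymbol\alpha\cdot\boldsymbol\beta=0\}$, a smooth 6-dimensional manifold; $\mathbf e_1,\mathbf e_2,\mathbf e_3$ is the canonical basis of $\mathbb R^3$. Equations of motion on $P^6$: $2\dot\omega_1=\omega_2(\omega_3-\lambda)+\beta_3$, $2\dot\omega_2=-\omega_1(\omega_3-\lambda)-\alpha_3$, $\dot\omega_3=\alpha_2-\beta_1$, $\dot{\boldsymbol\alpha}=\boldsymbol\alpha\times\boldsymbol\omega$, $\dot{\boldsymbol\beta}=\boldsymbol\beta\times\boldsymbol\omega$. An equilibrium is a singular point of this vector field. First integrals. With $\mathbf M=(2\omega_1,2\omega_2,\omega_3+\lambda)$, $M_\alpha=\mathbf M\cdot\boldsymbol\alpha$, $M_\beta=\mathbf M\cdot\boldsymbol\beta$,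 $M_\gamma=\mathbf M\cdot(\boldsymbol\alpha\times\boldsymbol\beta)$, put $$H=\omega_1^2+\omega_2^2+\tfrac12\omega_3^2-\alpha_1-\beta_2,$$ $$K=(\omega_1^2-\omega_2^2+\alpha_1-\beta_2)^2+(2\omega_1\omega_2+\alpha_2+\beta_1)^2+2\lambda[(\omega_3-\lambda)(\omega_1^2+\omega_2^2)+2\omega_1\alpha_3+2\omega_2\beta_3],$$ $$G=\tfrac14(M_\alpha^2+M_\beta^2)+\tfrac12(\omega_3-\lambda)M_\gamma-b^2\alpha_1-a^2\beta_2.$$ The momentum map is $J=(G,K,H):P^6\to\mathbb R^3$; $\operatorname{rank}J(\zeta)$ is the rank at $\zeta$ of the differential of $J$ on the tangent space of $P^6$. *)

theory Defs
  imports "HOL-Analysis.Analysis"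
begin

text \<open>
  Points of the ambient space are triples \<open>(\<omega>, \<alpha>, \<beta>)\<close>; \<open>lam\<close> is the gyrostatic
  parameter \<open>\<lambda>\<close>.
\<close>

type_synonym state = "(real^3) \<times> (real^3) \<times> (real^3)"

definition phase_space :: "real \<Rightarrow> real \<Rightarrow> state set" where
  "phase_space a b = {(\<omega>, \<alpha>, \<beta>). \<alpha> \<bullet> \<alpha> = a\<^sup>2 \<and> \<beta> \<bullet> \<beta> = b\<^sup>2 \<and> \<alpha> \<bullet> \<beta> = 0}"

text \<open>
  The equations of motion, solved for the velocities (the first two are given
  for \<open>2 \<omega>\<^sub>1'\<close> and \<open>2 \<omega>\<^sub>2'\<close>).
\<close>

definition gyrostat_field :: "real \<Rightarrow> state \<Rightarrow> state" where
  "gyrostat_field lam = (\<lambda>(\<omega>, \<alpha>, \<beta>).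
     (vector [(\<omega>$2 * (\<omega>$3 - lam) + \<beta>$3) / 2,
              (- \<omega>$1 * (\<omega>$3 - lam) - \<alpha>$3) / 2,
              \<alpha>$2 - \<beta>$1],
      cross3 \<alpha> \<omega>,
      cross3 \<beta> \<omega>))"

definition equilibria :: "real \<Rightarrow> real \<Rightarrow> real \<Rightarrow> state set" where
  "equilibria a b lam = {\<zeta> \<in> phase_space a b. gyrostat_field lam \<zeta> = 0}"

definition kinetic_momentum :: "real \<Rightarrow> real^3 \<Rightarrow> real^3" where
  "kinetic_momentum lam \<omega> = vector [2 * \<omega>$1, 2 * \<omega>$2, \<omega>$3 + lam]"

text \<open>
  The integrals are given by their formulas on the whole ambient space; only
  their restrictions to the phase space matter.
\<close>

definition integral_H :: "state \<Rightarrow> real" where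
  "integral_H = (\<lambda>(\<omega>, \<alpha>, \<beta>). (\<omega>$1)\<^sup>2 + (\<omega>$2)\<^sup>2 + (\<omega>$3)\<^sup>2 / 2 - \<alpha>$1 - \<beta>$2)"

definition integral_K :: "real \<Rightarrow> state \<Rightarrow> real" where
  "integral_K lam = (\<lambda>(\<omega>, \<alpha>, \<beta>).
     ((\<omega>$1)\<^sup>2 - (\<omega>$2)\<^sup>2 + \<alpha>$1 - \<beta>$2)\<^sup>2
     + (2 * \<omega>$1 * \<omega>$2 + \<alpha>$2 + \<beta>$1)\<^sup>2
     + 2 * lam * ((\<omega>$3 - lam) * ((\<omega>$1)\<^sup>2 + (\<omega>$2)\<^sup>2) + 2 * \<omega>$1 * \<alpha>$3 + 2 * \<omega>$2 * \<beta>$3))"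

definition integral_G :: "real \<Rightarrow> real \<Rightarrow> real \<Rightarrow> state \<Rightarrow> real" where
  "integral_G a b lam = (\<lambda>(\<omega>, \<alpha>, \<beta>).
     let M = kinetic_momentum lam \<omega>;
         M\<alpha> = M \<bullet> \<alpha>;
         M\<beta> = M \<bullet> \<beta>;
         M\<gamma> = M \<bullet> cross3 \<alpha> \<beta>
     in (M\<alpha>\<^sup>2 + M\<beta>\<^sup>2) / 4 + (\<omega>$3 - lam) * M\<gamma> / 2 - b\<^sup>2 * \<alpha>$1 - a\<^sup>2 * \<beta>$2)"

definition momentum_map :: "real \<Rightarrow> real \<Rightarrow> real \<Rightarrow> state \<Rightarrow> real \<times> real \<times> real" where
  "momentum_map a b lam \<zeta> = (integral_G a b lam \<zeta>, integral_K lam \<zeta>, integral_H \<zeta>)"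

text \<open>
  Tangent space of an embedded submanifold \<open>S\<close> at a point \<open>p \<in> S\<close>, as the set of
  velocities at \<open>p\<close> of \<open>C\<^sup>1\<close> curves running in \<open>S\<close>.
\<close>

definition tangent_space :: "'a::real_normed_vector set \<Rightarrow> 'a \<Rightarrow> 'a set" where
  "tangent_space S p = {v. \<exists>\<epsilon>>0. \<exists>c :: real \<Rightarrow> 'a.
     c C1_differentiable_on {-\<epsilon><..<\<epsilon>} \<and> c ` {-\<epsilon><..<\<epsilon>} \<subseteq> S \<and>
     c 0 = p \<and> (c has_vector_derivative v) (at 0)}"

text \<open>
  Rank at \<open>p\<close> of the differential of the restriction to \<open>S\<close> of a map that is
  differentiable on the ambient space.
\<close>

definition rank_on ::
    "'a::euclidean_space set \<Rightarrow> ('a \<Rightarrow> 'b::euclidean_space) \<Rightarrow> 'a \<Rightarrow> nat" where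
  "rank_on S F p = dim (frechet_derivative F (at p) ` tangent_space S p)"

definition critical_set_0 :: "real \<Rightarrow> real \<Rightarrow> real \<Rightarrow> state set" where
  "critical_set_0 a b lam =
     {\<zeta> \<in> phase_space a b. rank_on (phase_space a b) (momentum_map a b lam) \<zeta> = 0}"

end

theory Submission imports Defs begin

text \<open>
  Everything is governed by \<open>H\<close>. The tangent space of the phase space contains all
  \<open>(\<delta>\<omega>, \<alpha> \<times> u, \<beta> \<times> u)\<close>: the velocity is free and the orthogonal frame may be rotated
  about any axis \<open>u\<close>. Along such a vector
  \<open>dH = 2 \<omega>\<^sub>1 \<delta>\<omega>\<^sub>1 + 2 \<omega>\<^sub>2 \<delta>\<omega>\<^sub>2 + \<omega>\<^sub>3 \<delta>\<omega>\<^sub>3 - (\<alpha> \<times> u)\<^sub>1 - (\<beta> \<times> u)\<^sub>2\<close>, so \<open>dH = 0\<close> forces \<open>\<omega> = 0\<close>,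
  \<open>\<alpha>\<^sub>3 = \<beta>\<^sub>3 = 0\<close> and \<open>\<alpha>\<^sub>2 = \<beta>\<^sub>1\<close>. The equations of motion at rest lead to the same
  system: \<open>\<alpha> \<times> \<omega> = \<beta> \<times> \<omega> = 0\<close> kills \<open>\<omega>\<close>, as \<open>\<alpha>\<close> and \<open>\<beta>\<close> are independent, and the
  remaining components say the rest. Since \<open>\<alpha>\<close> and \<open>\<beta>\<close> then lie in a plane and are
  orthogonal of different lengths, \<open>\<alpha>\<^sub>2 = \<beta>\<^sub>1\<close> forces both to vanish, and only the four
  sign combinations are left (lemma \<open>rest_configuration_cases\<close>).

  Conversely, at these four points constancy of the lengths of \<open>\<alpha>\<close> and \<open>\<beta>\<close> gives
  \<open>\<delta>\<alpha>\<^sub>1 = \<delta>\<beta>\<^sub>2 = 0\<close> for every tangent vector, and the differentials of \<open>G\<close>, \<open>K\<close>, \<open>H\<close> all turn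
  out to be combinations of \<open>\<delta>\<alpha>\<^sub>1\<close> and \<open>\<delta>\<beta>\<^sub>2\<close> there, so the rank is \<open>0\<close>.
\<close>

section \<open>Tangent vectors of the phase space\<close>

lemma tangent_spaceI:
  assumes "\<And>t. (c has_vector_derivative c' t) (at t)" and "continuous_on UNIV c'"
    and "\<And>t. c t \<in> S"
  shows "c' 0 \<in> tangent_space S (c 0)"
proof -
  have "c C1_differentiable_on {-1<..<1}"
    unfolding C1_differentiable_on_def
    using assms(1) continuous_on_subset[OF assms(2)] by blast
  then show ?thesis
    unfolding tangent_space_def using assms(1,3)
    by (auto intro!: exI[of _ "1::real"] exI[of _ c])
qed

lemma tangent_phase_space_velocity:
  assumes "(\<omega>, \<alpha>, \<beta>) \<in> phase_space a b"
  shows "(d, 0, 0) \<in> tangent_space (phase_space a b) (\<omega>, \<alpha>, \<beta>)"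
proof -
  have "(\<lambda>t. (d, 0, 0)) (0::real)
      \<in> tangent_space (phase_space a b) ((\<lambda>t. (\<omega> + t *\<^sub>R d, \<alpha>, \<beta>)) 0)"
  proof (rule tangent_spaceI)
    show "((\<lambda>t. (\<omega> + t *\<^sub>R d, \<alpha>, \<beta>)) has_vector_derivative (d, 0, 0)) (at t)" for t :: real
      by (auto intro!: derivative_eq_intros simp: has_vector_derivative_def zero_prod_def)
  qed (use assms in \<open>auto simp: phase_space_def\<close>)
  then show ?thesis by simp
qed

text \<open>
  Rodrigues' formula for the rotation with axis \<open>u\<close> (a unit vector), oriented so that
  the velocity of \<open>x\<close> at angle \<open>0\<close> is \<open>x \<times> u\<close>, as in the equations of motion.
\<close>

definition axial_rotation :: "real^3 \<Rightarrow> real \<Rightarrow> real^3 \<Rightarrow> real^3" where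
  "axial_rotation u t x = cos t *\<^sub>R x + sin t *\<^sub>R cross3 x u + ((1 - cos t) * (u \<bullet> x)) *\<^sub>R u"

lemma inner_axial_rotation:
  assumes "u \<bullet> u = 1"
  shows "axial_rotation u t x \<bullet> axial_rotation u t y = x \<bullet> y"
proof -
  have *: "cross3 x u \<bullet> cross3 y u = x \<bullet> y - (u \<bullet> x) * (u \<bullet> y)"
    using assms by (simp add: dot_cross inner_commute)
  have **: "x \<bullet> cross3 y u = - (cross3 x u \<bullet> y)"
    by (simp add: cross3_simps)
  have "axial_rotation u t x \<bullet> axial_rotation u t y =
     (cos t)\<^sup>2 * (x \<bullet> y) + (sin t)\<^sup>2 * (x \<bullet> y - (u \<bullet> x) * (u \<bullet> y))
     + (2 * cos t * (1 - cos t) + (1 - cos t)\<^sup>2) * ((u \<bullet> x) * (u \<bullet> y))"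
    unfolding axial_rotation_def
    by (simp add: inner_simps dot_cross_self * ** assms inner_commute[of x u]
        inner_commute[of y u] algebra_simps power2_eq_square)
  also have "\<dots> = x \<bullet> y"
    unfolding sin_squared_eq by (simp add: algebra_simps power2_eq_square)
  finally show ?thesis .
qed

lemma tangent_phase_space_rotation:
  assumes "(\<omega>, \<alpha>, \<beta>) \<in> phase_space a b" and "u \<bullet> u = 1"
  shows "(0, cross3 \<alpha> u, cross3 \<beta> u) \<in> tangent_space (phase_space a b) (\<omega>, \<alpha>, \<beta>)"
proof -
  define R' where "R' t x = (- sin t) *\<^sub>R x + cos t *\<^sub>R cross3 x u + (sin t * (u \<bullet> x)) *\<^sub>R u"
    for t and x :: "real^3"
  have R: "((\<lambda>t. axial_rotation u t x) has_vector_derivative R' t x) (at t)" for t x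
    unfolding axial_rotation_def R'_def has_vector_derivative_def
    by (auto intro!: derivative_eq_intros simp: algebra_simps)
  have "(\<lambda>t. (0, R' t \<alpha>, R' t \<beta>)) (0::real) \<in> tangent_space (phase_space a b)
      ((\<lambda>t. (\<omega>, axial_rotation u t \<alpha>, axial_rotation u t \<beta>)) 0)"
  proof (rule tangent_spaceI)
    show "((\<lambda>t. (\<omega>, axial_rotation u t \<alpha>, axial_rotation u t \<beta>))
        has_vector_derivative (0, R' t \<alpha>, R' t \<beta>)) (at t)" for t
      by (intro has_vector_derivative_Pair R has_vector_derivative_const)
    show "continuous_on UNIV (\<lambda>t. (0::real^3, R' t \<alpha>, R' t \<beta>))"
      unfolding R'_def by (intro continuous_intros)
    show "(\<omega>, axial_rotation u t \<alpha>, axial_rotation u t \<beta>) \<in> phase_space a b" for t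
      using assms by (simp add: phase_space_def inner_axial_rotation)
  qed
  then show ?thesis by (simp add: R'_def axial_rotation_def)
qed

text \<open>Curves in the phase space keep the lengths of \<open>\<alpha>\<close> and \<open>\<beta>\<close> fixed.\<close>

lemma tangent_phase_space_constraints:
  assumes "(d\<omega>, d\<alpha>, d\<beta>) \<in> tangent_space (phase_space a b) (\<omega>, \<alpha>, \<beta>)"
  shows "\<alpha> \<bullet> d\<alpha> = 0" and "\<beta> \<bullet> d\<beta> = 0"
proof -
  obtain e c where e: "e > 0" and S: "c ` {-e<..<e} \<subseteq> phase_space a b" and c0: "c 0 = (\<omega>, \<alpha>, \<beta>)"
    and c: "(c has_vector_derivative (d\<omega>, d\<alpha>, d\<beta>)) (at (0::real))"
    using assms unfolding tangent_space_def by blast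
  define f where "f t = fst (snd (c t))" for t
  define g where "g t = snd (snd (c t))" for t
  have f: "(f has_derivative (\<lambda>h. h *\<^sub>R d\<alpha>)) (at 0)" and g: "(g has_derivative (\<lambda>h. h *\<^sub>R d\<beta>)) (at 0)"
    unfolding f_def g_def
    using c unfolding has_vector_derivative_def by (auto intro!: derivative_eq_intros)
  have f0: "f 0 = \<alpha>" and g0: "g 0 = \<beta>" by (simp_all add: f_def g_def c0)
  have on: "f t \<bullet> f t = a\<^sup>2 \<and> g t \<bullet> g t = b\<^sup>2" if "t \<in> {-e<..<e}" for t
    using S that unfolding f_def g_def phase_space_def by (force split: prod.splits)
  have const: "D = (\<lambda>h. 0)" if "(\<phi> has_derivative D) (at 0)" and "\<And>t. t \<in> {-e<..<e} \<Longrightarrow> \<phi> t = k"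
    for \<phi> :: "real \<Rightarrow> real" and D k
  proof -
    have "((\<lambda>_. k) has_derivative D) (at 0)"
      by (rule has_derivative_transform_within_open[OF that(1), of "{-e<..<e}"]) (use e that in auto)
    then show ?thesis by (rule has_derivative_unique) (rule has_derivative_const)
  qed
  have "(\<lambda>h. f 0 \<bullet> (h *\<^sub>R d\<alpha>) + (h *\<^sub>R d\<alpha>) \<bullet> f 0) = (\<lambda>h. 0)"
    by (rule const[OF has_derivative_inner[OF f f]]) (use on in auto)
  from fun_cong[OF this, of 1] show "\<alpha> \<bullet> d\<alpha> = 0" by (simp add: f0 inner_commute)
  have "(\<lambda>h. g 0 \<bullet> (h *\<^sub>R d\<beta>) + (h *\<^sub>R d\<beta>) \<bullet> g 0) = (\<lambda>h. 0)"
    by (rule const[OF has_derivative_inner[OF g g]]) (use on in auto)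
  from fun_cong[OF this, of 1] show "\<beta> \<bullet> d\<beta> = 0" by (simp add: g0 inner_commute)
qed

section \<open>Differentials of the integrals\<close>

lemma has_derivative_vec_nth [derivative_intros]:
  "(f has_derivative f') F \<Longrightarrow> ((\<lambda>x. f x $ i) has_derivative (\<lambda>h. f' h $ i)) F"
  by (rule bounded_linear.has_derivative[OF bounded_linear_vec_nth])

lemma has_derivative_cross3 [derivative_intros]:
  assumes "(f has_derivative f') (at x within s)" and "(g has_derivative g') (at x within s)"
  shows "((\<lambda>x. cross3 (f x) (g x)) has_derivative
    (\<lambda>h. cross3 (f x) (g' h) + cross3 (f' h) (g x))) (at x within s)"
  using bilinear_cross assms
  by (simp add: bilinear_conv_bounded_bilinear bounded_bilinear.FDERIV)

lemma has_derivative_kinetic_momentum [derivative_intros]: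
  assumes "(f has_derivative f') F"
  shows "((\<lambda>x. kinetic_momentum lam (f x)) has_derivative (\<lambda>h. kinetic_momentum 0 (f' h))) F"
proof -
  have split: "kinetic_momentum lam w = kinetic_momentum 0 w + lam *\<^sub>R axis 3 1" for w
    by (simp add: kinetic_momentum_def vec_eq_iff forall_3 axis_def)
  have "linear (kinetic_momentum 0)"
    by (rule linearI) (simp_all add: kinetic_momentum_def vec_eq_iff forall_3 algebra_simps)
  then have "bounded_linear (kinetic_momentum 0)" by (simp add: linear_conv_bounded_linear)
  from bounded_linear.has_derivative[OF this assms] show ?thesis
    unfolding split[of "f _"] by (auto intro!: derivative_eq_intros)
qed

lemma has_derivative_integral_H:
  "(integral_H has_derivative (\<lambda>(d\<omega>, d\<alpha>, d\<beta>).
     2 * \<omega>$1 * d\<omega>$1 + 2 * \<omega>$2 * d\<omega>$2 + \<omega>$3 * d\<omega>$3 - d\<alpha>$1 - d\<beta>$2)) (at (\<omega>, \<alpha>, \<beta>))"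
  unfolding integral_H_def case_prod_beta'
  by (auto intro!: derivative_eq_intros)

lemma has_derivative_integral_K:
  "(integral_K lam has_derivative (\<lambda>(d\<omega>, d\<alpha>, d\<beta>).
     2 * ((\<omega>$1)\<^sup>2 - (\<omega>$2)\<^sup>2 + \<alpha>$1 - \<beta>$2)
       * (2 * \<omega>$1 * d\<omega>$1 - 2 * \<omega>$2 * d\<omega>$2 + d\<alpha>$1 - d\<beta>$2)
     + 2 * (2 * \<omega>$1 * \<omega>$2 + \<alpha>$2 + \<beta>$1)
       * (2 * \<omega>$1 * d\<omega>$2 + 2 * d\<omega>$1 * \<omega>$2 + d\<alpha>$2 + d\<beta>$1)
     + 2 * lam * (d\<omega>$3 * ((\<omega>$1)\<^sup>2 + (\<omega>$2)\<^sup>2)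
       + (\<omega>$3 - lam) * (2 * \<omega>$1 * d\<omega>$1 + 2 * \<omega>$2 * d\<omega>$2)
       + 2 * \<omega>$1 * d\<alpha>$3 + 2 * d\<omega>$1 * \<alpha>$3 + 2 * \<omega>$2 * d\<beta>$3 + 2 * d\<omega>$2 * \<beta>$3)))
   (at (\<omega>, \<alpha>, \<beta>))"
  unfolding integral_K_def case_prod_beta'
  by (auto intro!: derivative_eq_intros simp: algebra_simps)

lemma has_derivative_integral_G:
  fixes a b lam :: real
  defines "M \<equiv> kinetic_momentum lam" and "dM \<equiv> kinetic_momentum 0"
  shows "(integral_G a b lam has_derivative (\<lambda>(d\<omega>, d\<alpha>, d\<beta>).
     ((M \<omega> \<bullet> \<alpha>) * (M \<omega> \<bullet> d\<alpha> + dM d\<omega> \<bullet> \<alpha>) + (M \<omega> \<bullet> \<beta>) * (M \<omega> \<bullet> d\<beta> + dM d\<omega> \<bullet> \<beta>)) / 2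
     + d\<omega>$3 * (M \<omega> \<bullet> cross3 \<alpha> \<beta>) / 2
     + (\<omega>$3 - lam)
       * (M \<omega> \<bullet> (cross3 \<alpha> d\<beta> + cross3 d\<alpha> \<beta>) + dM d\<omega> \<bullet> cross3 \<alpha> \<beta>) / 2
     - b\<^sup>2 * d\<alpha>$1 - a\<^sup>2 * d\<beta>$2))
   (at (\<omega>, \<alpha>, \<beta>))"
  unfolding integral_G_def case_prod_beta' Let_def M_def dM_def
  by (auto intro!: derivative_eq_intros simp: field_simps)

lemma rank_on_eq_0_iff:
  assumes "(F has_derivative F') (at p)"
  shows "rank_on S F p = 0 \<longleftrightarrow> (\<forall>v \<in> tangent_space S p. F' v = 0)"
  unfolding rank_on_def frechet_derivative_at[OF assms, symmetric] dim_eq_0 by auto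

lemma has_derivative_momentum_map:
  assumes "(integral_G a b lam has_derivative G') (at p)"
    and "(integral_K lam has_derivative K') (at p)" and "(integral_H has_derivative H') (at p)"
  shows "(momentum_map a b lam has_derivative (\<lambda>v. (G' v, K' v, H' v))) (at p)"
  unfolding momentum_map_def[abs_def] by (intro has_derivative_Pair assms)

section \<open>Configurations at rest\<close>

text \<open>
  The system reached both from \<open>dH = 0\<close> and from the equations of motion. With
  \<open>s = \<alpha>\<^sub>2 = \<beta>\<^sub>1\<close>, orthogonality reads \<open>s (\<alpha>\<^sub>1 + \<beta>\<^sub>2) = 0\<close>, and \<open>\<alpha>\<^sub>1 = - \<beta>\<^sub>2\<close> would give \<open>\<alpha>\<close> and
  \<open>\<beta>\<close> equal lengths.
\<close>

lemma rest_configuration_cases: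
  fixes \<alpha> \<beta> :: "real^3"
  assumes "\<bar>a\<bar> \<noteq> \<bar>b\<bar>" and "(\<omega>, \<alpha>, \<beta>) \<in> phase_space a b"
    and "\<alpha>$3 = 0" and "\<beta>$3 = 0" and "\<alpha>$2 = \<beta>$1"
  shows "\<alpha> \<in> {a *\<^sub>R axis 1 1, - a *\<^sub>R axis 1 1} \<and> \<beta> \<in> {b *\<^sub>R axis 2 1, - b *\<^sub>R axis 2 1}"
proof -
  have \<alpha>: "(\<alpha>$1)\<^sup>2 + (\<beta>$1)\<^sup>2 = a\<^sup>2" and \<beta>: "(\<beta>$1)\<^sup>2 + (\<beta>$2)\<^sup>2 = b\<^sup>2"
    and orth: "\<beta>$1 * (\<alpha>$1 + \<beta>$2) = 0"
    using assms(2-) by (auto simp: phase_space_def inner_vec_def sum_3 power2_eq_square algebra_simps)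
  have s: "\<beta>$1 = 0"
  proof (rule ccontr)
    assume "\<beta>$1 \<noteq> 0"
    with orth have "\<alpha>$1 = - \<beta>$2" by simp
    with \<alpha> \<beta> have "a\<^sup>2 = b\<^sup>2" by simp
    with assms(1) show False by (simp add: power2_eq_iff) (metis abs_minus_cancel)
  qed
  then have "\<alpha>$1 = a \<or> \<alpha>$1 = - a" and "\<beta>$2 = b \<or> \<beta>$2 = - b"
    using \<alpha> \<beta> by (simp_all add: power2_eq_iff)
  then show ?thesis
    using s assms(3-) by (auto simp: vec_eq_iff forall_3 axis_def)
qed

definition rest_points :: "real \<Rightarrow> real \<Rightarrow> state set" where
  "rest_points a b = {0} \<times> {a *\<^sub>R axis 1 1, - a *\<^sub>R axis 1 1} \<times> {b *\<^sub>R axis 2 1, - b *\<^sub>R axis 2 1}"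

lemma rest_points_subset_phase_space: "rest_points a b \<subseteq> phase_space a b"
  by (auto simp: rest_points_def phase_space_def inner_axis_axis power2_eq_square)

lemma card_rest_points:
  assumes "a \<noteq> 0" and "b \<noteq> 0"
  shows "card (rest_points a b) = 4"
proof -
  have "a *\<^sub>R axis 1 1 \<noteq> (- a *\<^sub>R axis 1 1 :: real^3)" "b *\<^sub>R axis 2 1 \<noteq> (- b *\<^sub>R axis 2 1 :: real^3)"
    using assms by (auto simp: vec_eq_iff forall_3 axis_def)
  then show ?thesis by (simp add: rest_points_def card_cartesian_product)
qed

text \<open>
  By Lagrange's identity \<open>(x \<bullet> y) (w \<bullet> w) = (x \<bullet> w) (y \<bullet> w)\<close>, so \<open>w\<close> is orthogonal to one of the
  vectors it is parallel to. This is how the angular velocity disappears from the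
  equations of motion.
\<close>

lemma cross3_orthogonal_pair_eq_0:
  assumes "cross3 x w = 0" and "cross3 y w = 0" and "x \<bullet> y = 0" and "x \<noteq> 0" and "y \<noteq> 0"
  shows "w = 0"
proof (rule ccontr)
  assume "w \<noteq> 0"
  have "(x \<bullet> y) * (w \<bullet> w) = (x \<bullet> w) * (w \<bullet> y)"
    using dot_cross[of x w y w] assms(1) by (simp add: inner_commute)
  with assms(3) consider "x \<bullet> w = 0" | "y \<bullet> w = 0" by (auto simp: inner_commute)
  then show False
    using norm_and_cross_eq_0[of x w] norm_and_cross_eq_0[of y w] assms \<open>w \<noteq> 0\<close> by cases auto
qed

lemma equilibria_eq_rest_points:
  assumes "\<bar>a\<bar> \<noteq> \<bar>b\<bar>" and "a \<noteq> 0" and "b \<noteq> 0"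
  shows "equilibria a b lam = rest_points a b"
proof (intro equalityI subsetI)
  fix \<zeta> assume \<zeta>: "\<zeta> \<in> equilibria a b lam"
  obtain \<omega> \<alpha> \<beta> where [simp]: "\<zeta> = (\<omega>, \<alpha>, \<beta>)" by (cases \<zeta>)
  from \<zeta> have P: "(\<omega>, \<alpha>, \<beta>) \<in> phase_space a b" and field: "gyrostat_field lam (\<omega>, \<alpha>, \<beta>) = 0"
    by (auto simp: equilibria_def)
  from P assms have "\<alpha> \<noteq> 0" "\<beta> \<noteq> 0" "\<alpha> \<bullet> \<beta> = 0" by (auto simp: phase_space_def)
  with field have \<omega>: "\<omega> = 0"
    using cross3_orthogonal_pair_eq_0[of \<alpha> \<omega> \<beta>] by (simp add: gyrostat_field_def zero_prod_def)
  with field have "\<beta>$3 = 0" "\<alpha>$3 = 0" "\<alpha>$2 = \<beta>$1"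
    by (simp_all add: gyrostat_field_def zero_prod_def vec_eq_iff forall_3)
  with rest_configuration_cases[OF assms(1) P] \<omega> show "\<zeta> \<in> rest_points a b"
    by (auto simp: rest_points_def)
next
  fix \<zeta> assume \<zeta>: "\<zeta> \<in> rest_points a b"
  then have "gyrostat_field lam \<zeta> = 0"
    by (auto simp: rest_points_def gyrostat_field_def zero_prod_def vec_eq_iff forall_3 axis_def)
  with \<zeta> rest_points_subset_phase_space show "\<zeta> \<in> equilibria a b lam"
    by (auto simp: equilibria_def)
qed

section \<open>Critical points of rank zero\<close>

text \<open>
  Testing \<open>dH\<close> on \<open>\<delta>\<omega> = \<omega>\<close> gives a sum of squares, and testing it on rotations about
  the three coordinate axes gives the three equations for \<open>\<alpha>\<close> and \<open>\<beta>\<close>.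
\<close>

lemma critical_set_0_subset_rest_points:
  assumes "\<bar>a\<bar> \<noteq> \<bar>b\<bar>"
  shows "critical_set_0 a b lam \<subseteq> rest_points a b"
proof
  fix \<zeta> assume \<zeta>: "\<zeta> \<in> critical_set_0 a b lam"
  obtain \<omega> \<alpha> \<beta> where [simp]: "\<zeta> = (\<omega>, \<alpha>, \<beta>)" by (cases \<zeta>)
  from \<zeta> have P: "(\<omega>, \<alpha>, \<beta>) \<in> phase_space a b"
    and rank: "rank_on (phase_space a b) (momentum_map a b lam) (\<omega>, \<alpha>, \<beta>) = 0"
    by (auto simp: critical_set_0_def)
  note D = has_derivative_momentum_map[OF has_derivative_integral_G has_derivative_integral_K
      has_derivative_integral_H]
  have dH: "2 * \<omega>$1 * d\<omega>$1 + 2 * \<omega>$2 * d\<omega>$2 + \<omega>$3 * d\<omega>$3 - d\<alpha>$1 - d\<beta>$2 = 0"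
    if "(d\<omega>, d\<alpha>, d\<beta>) \<in> tangent_space (phase_space a b) (\<omega>, \<alpha>, \<beta>)" for d\<omega> d\<alpha> d\<beta>
    using bspec[OF rank[unfolded rank_on_eq_0_iff[OF D]] that] by (simp add: zero_prod_def)
  have "2 * (\<omega>$1)\<^sup>2 + 2 * (\<omega>$2)\<^sup>2 + (\<omega>$3)\<^sup>2 = 0"
    using dH[OF tangent_phase_space_velocity[OF P, of \<omega>]] by (simp add: power2_eq_square)
  then have "(\<omega>$1)\<^sup>2 = 0" "(\<omega>$2)\<^sup>2 = 0" "(\<omega>$3)\<^sup>2 = 0"
    using zero_le_power2[of "\<omega>$1"] zero_le_power2[of "\<omega>$2"] zero_le_power2[of "\<omega>$3"] by linarith+
  then have \<omega>: "\<omega> = 0" by (simp add: vec_eq_iff forall_3)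
  have rot: "cross3 \<alpha> (axis i 1) $ 1 + cross3 \<beta> (axis i 1) $ 2 = 0" for i
    using dH[OF tangent_phase_space_rotation[OF P, of "axis i 1"]] by (simp add: inner_axis_axis)
  have "\<beta>$3 = 0" "\<alpha>$3 = 0" "\<alpha>$2 = \<beta>$1"
    using rot[of 1] rot[of 2] rot[of 3] by (simp_all add: cross3_def axis_def)
  with rest_configuration_cases[OF assms P] \<omega> show "\<zeta> \<in> rest_points a b"
    by (auto simp: rest_points_def)
qed

text \<open>
  At a rest point \<open>\<alpha>\<close> and \<open>\<beta>\<close> point along the first two axes, so constancy
  of their lengths gives \<open>\<delta>\<alpha>\<^sub>1 = \<delta>\<beta>\<^sub>2 = 0\<close>. In \<open>dG\<close> the two terms with \<open>\<delta>\<omega>\<^sub>3\<close>, coming from the factors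
  \<open>\<omega>\<^sub>3 - \<lambda>\<close> and \<open>M\<^sub>\<gamma>\<close>, are opposite.
\<close>

lemma rest_points_subset_critical_set_0:
  assumes "a \<noteq> 0" and "b \<noteq> 0"
  shows "rest_points a b \<subseteq> critical_set_0 a b lam"
proof
  fix \<zeta> assume \<zeta>: "\<zeta> \<in> rest_points a b"
  obtain \<omega> \<alpha> \<beta> where [simp]: "\<zeta> = (\<omega>, \<alpha>, \<beta>)" by (cases \<zeta>)
  from \<zeta> have \<omega>: "\<omega> = 0"
    and comp: "\<alpha>$2 = 0" "\<alpha>$3 = 0" "\<beta>$1 = 0" "\<beta>$3 = 0" "\<alpha>$1 \<noteq> 0" "\<beta>$2 \<noteq> 0"
    using assms by (auto simp: rest_points_def axis_def)
  note D = has_derivative_momentum_map[OF has_derivative_integral_G has_derivative_integral_K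
      has_derivative_integral_H]
  have "d\<alpha>$1 = 0 \<and> d\<beta>$2 = 0"
    if "(d\<omega>, d\<alpha>, d\<beta>) \<in> tangent_space (phase_space a b) (\<omega>, \<alpha>, \<beta>)" for d\<omega> d\<alpha> d\<beta>
    using tangent_phase_space_constraints[OF that] comp by (simp add: inner_vec_def sum_3)
  then have "rank_on (phase_space a b) (momentum_map a b lam) (\<omega>, \<alpha>, \<beta>) = 0"
    unfolding rank_on_eq_0_iff[OF D]
    using \<omega> comp
    by (auto simp: zero_prod_def kinetic_momentum_def cross3_def inner_vec_def sum_3)
  with \<zeta> rest_points_subset_phase_space show "\<zeta> \<in> critical_set_0 a b lam"
    by (auto simp: critical_set_0_def)
qed

theorem proposition1:
  fixes a b lam :: real
  assumes "a > b" and "b > 0" and "lam \<noteq> 0"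
  shows "critical_set_0 a b lam = equilibria a b lam
    \<and> equilibria a b lam =
        {(0, a *\<^sub>R axis 1 1, b *\<^sub>R axis 2 1),
         (0, a *\<^sub>R axis 1 1, - b *\<^sub>R axis 2 1),
         (0, - a *\<^sub>R axis 1 1, b *\<^sub>R axis 2 1),
         (0, - a *\<^sub>R axis 1 1, - b *\<^sub>R axis 2 1)}
    \<and> card (equilibria a b lam) = 4"
proof -
  have ab: "\<bar>a\<bar> \<noteq> \<bar>b\<bar>" "a \<noteq> 0" "b \<noteq> 0" using assms by auto
  have "critical_set_0 a b lam = rest_points a b"
    using critical_set_0_subset_rest_points[OF ab(1)] rest_points_subset_critical_set_0[OF ab(2,3)]
    by blast
  moreover have "rest_points a b =
        {(0, a *\<^sub>R axis 1 1, b *\<^sub>R axis 2 1),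
         (0, a *\<^sub>R axis 1 1, - b *\<^sub>R axis 2 1),
         (0, - a *\<^sub>R axis 1 1, b *\<^sub>R axis 2 1),
         (0, - a *\<^sub>R axis 1 1, - b *\<^sub>R axis 2 1)}"
    unfolding rest_points_def by auto
  ultimately show ?thesis
    using equilibria_eq_rest_points[OF ab] card_rest_points[OF ab(2,3)] by simp
qed

end
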